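(* Let $x$ be a parameter and let $F=F(t,x)=\frac{1}{2+t}(1+t)^x$. For every integer $N\ge 0$, \[ F^{(N)}:=\left(\frac{d}{dt}\right)^N F(t,x)=\left(\sum_{i=0}^{N}a_i(N,x)(1+t)^{-i}(2+t)^{i-N}\right)F, \] where \[ a_0(N,x)=(-1)^N N!, \] and, for $1\le j\le N$, \[ a_j(N,x)=(x)_j(-1)^{N-j}(N-j)!\sum_{i_{j-1}=0}^{N-j}\ \sum_{i_{j-2}=0}^{N-j-i_{j-1}}\cdots\sum_{i_1=0}^{N-j-i_{j-1}-\cdots-i_2}\bigl(N-i_{j-1}-\cdots-i_1-j+1\bigr). \]
   Context: $(x)_0=1$ and $(x)_n=x(x-1)\cdots(x-n+1)$ for $n\ge1$ denotes the falling factorial. In the formula for $a_j(N,x)$ there are $j-1$ nested summations over $i_{j-1},\dots,i_1$; when $j=1$ there are no summations and the expression is just the summand $N-j+1=N$, so $a_1(N,x)=(-1)^{N-1}N!\,x$. *)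

theory Defs
  imports "HOL-Analysis.Analysis"
begin

definition falling_factorial :: "'a::comm_ring_1 \<Rightarrow> nat \<Rightarrow> 'a" where
  "falling_factorial x n = (\<Prod>k<n. x - of_nat k)"

text \<open>
  Both real and complex arguments are covered; \<open>powr\<close> is the real power function on the
  positive reals and the principal branch on the complex numbers.
\<close>

definition F :: "'a::{real_normed_field,ln} \<Rightarrow> 'a \<Rightarrow> 'a" where
  "F x t = 1 / (2 + t) * (1 + t) powr x"

text \<open>
  \<open>nested_sum k M s g\<close> is a block of \<open>k\<close> nested sums of \<open>g\<close> over the total of all indices, where \<open>s\<close>
  is the total of the indices already chosen by the enclosing sums:
  \[ \sum_{i_k=0}^{M-s} \sum_{i_{k-1}=0}^{M-s-i_k} \cdots \sum_{i_1=0}^{M-s-i_k-\cdots-i_2}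
     g(s+i_k+\cdots+i_1). \]
  Started at \<open>s = 0\<close>, the total never exceeds \<open>M\<close>, so the truncated subtraction is exact.
\<close>

primrec nested_sum :: "nat \<Rightarrow> nat \<Rightarrow> nat \<Rightarrow> (nat \<Rightarrow> 'a::comm_monoid_add) \<Rightarrow> 'a" where
  "nested_sum 0 M s g = g s"
| "nested_sum (Suc k) M s g = (\<Sum>i = 0..M - s. nested_sum k M (s + i) g)"

text \<open>Only the values for \<open>j \<le> N\<close> are meaningful.\<close>

definition coeff_a :: "nat \<Rightarrow> nat \<Rightarrow> 'a::field_char_0 \<Rightarrow> 'a" where
  "coeff_a j N x =
     (if j = 0 then (-1) ^ N * fact N
      else falling_factorial x j * (-1) ^ (N - j) * fact (N - j) *
           nested_sum (j - 1) (N - j) 0 (\<lambda>s. of_nat N - of_nat s - of_nat j + 1))"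

end

(* Leibniz' rule for the product of 1 / (2 + t) and (1 + t) powr x gives the coefficients
   N choose j times (x)_j times (-1)^(N - j) times (N - j)!, and iterating the hockey-stick
   identity shows that the nested sum in a_j(N, x) equals N choose j. *)
theory Submission
  imports Defs
begin

text \<open>The innermost summand is itself a binomial coefficient,
  \<open>(M - s + 1) choose 1\<close>, and each summation raises both entries by one. Peeling off
  the outermost sum turns \<open>s\<close> into \<open>s + i\<close>, so the induction needs
  arbitrary \<open>s\<close>.\<close>

lemma nested_sum_eq_choose:
  assumes "s \<le> M"
  shows "nested_sum k M s (\<lambda>s. of_nat (Suc M) - of_nat s) =
    (of_nat ((M - s + Suc k) choose Suc k) :: 'a::comm_ring_1)"
  using assms
proof (induction k arbitrary: s)
  case 0
  then show ?case by (simp add: of_nat_diff)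
next
  case (Suc k)
  have "nested_sum (Suc k) M s (\<lambda>s. of_nat (Suc M) - of_nat s :: 'a) =
      of_nat (\<Sum>i\<le>M - s. (M - s - i + Suc k) choose Suc k)"
    unfolding nested_sum.simps of_nat_sum atLeast0AtMost
  proof (rule sum.cong[OF refl])
    fix i assume "i \<in> {..M - s}"
    with Suc.prems have "s + i \<le> M" by simp
    from Suc.IH[OF this] show "nested_sum k M (s + i) (\<lambda>s. of_nat (Suc M) - of_nat s :: 'a) =
        of_nat ((M - s - i + Suc k) choose Suc k)"
      by (simp only: diff_diff_left)
  qed
  \<comment> \<open>Reversing the order of summation turns the falling upper entry into a rising
    one, as the hockey-stick identity requires.\<close>
  also have "(\<Sum>i\<le>M - s. (M - s - i + Suc k) choose Suc k) = (\<Sum>i\<le>M - s. (i + Suc k) choose Suc k)"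
    by (rule sum.reindex_bij_witness[of _ "\<lambda>i. M - s - i" "\<lambda>i. M - s - i"]; simp)
  also have "\<dots> = (M - s + Suc (Suc k)) choose Suc (Suc k)"
  proof -
    \<comment> \<open>\<open>sum_choose_lower\<close> lets the index run in both entries, so each
      binomial is first replaced by its symmetric counterpart.\<close>
    have choose_swap: "(i + r) choose r = (r + i) choose i" for i r :: nat
      by (metis add.commute add_diff_cancel_right' binomial_symmetric le_add2)
    show ?thesis
      unfolding choose_swap[of _ "Suc k"] choose_swap[of _ "Suc (Suc k)"] sum_choose_lower
      by (simp only: add_Suc)
  qed
  finally show ?case .
qed

lemma coeff_a_eq_choose:
  assumes "j \<le> N"
  shows "coeff_a j N x =
    falling_factorial x j * (-1) ^ (N - j) * fact (N - j) * of_nat (N choose j)"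
proof (cases j)
  case 0
  then show ?thesis by (simp add: coeff_a_def falling_factorial_def)
next
  case (Suc k)
  \<comment> \<open>This is the summand above with \<open>M = N - j\<close>; with
    \<open>k = j - 1\<close> and \<open>s = 0\<close> the nested sum is
    \<open>(N - j + j) choose j\<close>.\<close>
  have "(\<lambda>s. of_nat N - of_nat s - of_nat j + 1 :: 'a) =
      (\<lambda>s. of_nat (Suc (N - j)) - of_nat s)"
    using assms by (auto simp: of_nat_diff)
  then show ?thesis
    using assms Suc by (simp only: coeff_a_def nested_sum_eq_choose) simp
qed

text \<open>Leibniz' rule, with the successive derivatives of both factors supplied as explicit
  families \<open>p\<close> and \<open>q\<close>. The set is open because the inductive step
  differentiates a formula that must hold near \<open>u\<close>, not just at
  \<open>u\<close>.\<close>

lemma funpow_deriv_mult: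
  fixes p q :: "nat \<Rightarrow> 'a::real_normed_field \<Rightarrow> 'a"
  assumes S: "open S"
    and p: "\<And>j u. u \<in> S \<Longrightarrow> (p j has_field_derivative p (Suc j) u) (at u)"
    and q: "\<And>j u. u \<in> S \<Longrightarrow> (q j has_field_derivative q (Suc j) u) (at u)"
    and u: "u \<in> S"
  shows "(deriv ^^ n) (\<lambda>u. p 0 u * q 0 u) u =
    (\<Sum>j\<le>n. of_nat (n choose j) * (p j u * q (n - j) u))"
  using u
proof (induction n arbitrary: u)
  case 0
  then show ?case by simp
next
  case (Suc n)
  let ?D = "\<Sum>j\<le>n. of_nat (n choose j) * (p (Suc j) u * q (n - j) u + q (Suc (n - j)) u * p j u)"
  have "((\<lambda>u. \<Sum>j\<le>n. of_nat (n choose j) * (p j u * q (n - j) u)) has_field_derivative ?D) (at u)"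
    by (intro DERIV_sum DERIV_cmult DERIV_mult p q Suc.prems)
  then have "((deriv ^^ n) (\<lambda>u. p 0 u * q 0 u) has_field_derivative ?D) (at u)"
    by (rule has_field_derivative_transform_within_open[OF _ S Suc.prems]) (simp add: Suc.IH)
  then have "(deriv ^^ Suc n) (\<lambda>u. p 0 u * q 0 u) u = ?D"
    by (simp add: DERIV_imp_deriv)
  also have "\<dots> = (\<Sum>j\<le>n. of_nat (n choose j) * (p (Suc j) u * q (n - j) u)) +
      (\<Sum>j\<le>n. of_nat (n choose j) * (p j u * q (Suc n - j) u))"
    by (simp add: sum.distrib[symmetric] algebra_simps Suc_diff_le)
  \<comment> \<open>The added term \<open>j = Suc n\<close> vanishes because
    \<open>n choose Suc n = 0\<close>. Splitting off \<open>j = 0\<close> instead then aligns this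
    sum with the other one.\<close>
  also have "(\<Sum>j\<le>n. of_nat (n choose j) * (p j u * q (Suc n - j) u)) =
      (\<Sum>j\<le>Suc n. of_nat (n choose j) * (p j u * q (Suc n - j) u))"
    by simp
  also have "\<dots> = p 0 u * q (Suc n) u +
      (\<Sum>j\<le>n. of_nat (n choose Suc j) * (p (Suc j) u * q (n - j) u))"
    by (subst sum.atMost_Suc_shift) simp
  \<comment> \<open>Pascal's rule adds the coefficients \<open>n choose j\<close> and
    \<open>n choose Suc j\<close>.\<close>
  also have "(\<Sum>j\<le>n. of_nat (n choose j) * (p (Suc j) u * q (n - j) u)) + \<dots> =
      (\<Sum>j\<le>Suc n. of_nat (Suc n choose j) * (p j u * q (Suc n - j) u))"
    unfolding sum.atMost_Suc_shift[of "\<lambda>j. of_nat (Suc n choose j) * (p j u * q (Suc n - j) u)"]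
    by (simp add: sum.distrib algebra_simps)
  finally show ?case .
qed

lemma falling_factorial_Suc: "falling_factorial x (Suc n) = falling_factorial x n * (x - of_nat n)"
  by (simp add: falling_factorial_def)

text \<open>Serves the real and the complex case at once: what depends on the field, namely the
  domain and the derivative of \<open>powr\<close> on it, enters as a hypothesis.\<close>

lemma funpow_deriv_F:
  fixes x t :: "'a::{real_normed_field,ln}"
  assumes S: "open S" and t: "t \<in> S"
    and nz: "\<And>u. u \<in> S \<Longrightarrow> 1 + u \<noteq> 0" "\<And>u. u \<in> S \<Longrightarrow> 2 + u \<noteq> 0"
    and powr: "\<And>u. u \<in> S \<Longrightarrow>
      ((\<lambda>u. (1 + u) powr x) has_field_derivative x * (1 + u) powr x / (1 + u)) (at u)"
  shows "(deriv ^^ N) (\<lambda>u. F x u) t =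
    (\<Sum>i = 0..N. coeff_a i N x * (1 + t) powi (- int i) * (2 + t) powi (int i - int N)) * F x t"
proof -
  \<comment> \<open>Closed forms of the derivatives of \<open>(1 + u) powr x\<close> and
    \<open>1 / (2 + u)\<close>. Dividing by \<open>(1 + u) ^ j\<close> keeps the exponent of
    \<open>powr\<close> fixed at \<open>x\<close>, the only one whose derivative is assumed.\<close>
  define p where "p j u = falling_factorial x j * ((1 + u) powr x / (1 + u) ^ j)" for j u
  define q :: "nat \<Rightarrow> 'a \<Rightarrow> 'a" where "q m u = (-1) ^ m * fact m * (1 / (2 + u) ^ Suc m)" for m u
  have p: "(p j has_field_derivative p (Suc j) u) (at u)" if u: "u \<in> S" for j u
  proof -
    have "((\<lambda>u. (1 + u) powr x / (1 + u) ^ j) has_field_derivative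
        (x * (1 + u) powr x / (1 + u) * (1 + u) ^ j -
          (1 + u) powr x * (of_nat j * (1 + u) ^ (j - 1))) / ((1 + u) ^ j * (1 + u) ^ j)) (at u)"
      using nz(1)[OF u] by (auto intro!: derivative_eq_intros powr[OF u])
    also have "(x * (1 + u) powr x / (1 + u) * (1 + u) ^ j -
          (1 + u) powr x * (of_nat j * (1 + u) ^ (j - 1))) / ((1 + u) ^ j * (1 + u) ^ j) =
        (x - of_nat j) * ((1 + u) powr x / (1 + u) ^ Suc j)"
    proof -
      \<comment> \<open>With \<open>c\<close> and \<open>v\<close> as atoms only a rational identity
        remains. The truncated exponent \<open>j - 1\<close> forces the case split; for
        \<open>j = 0\<close> its term has the factor zero.\<close>
      have "(x * c / v * v ^ j - c * (of_nat j * v ^ (j - 1))) / (v ^ j * v ^ j) =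
          (x - of_nat j) * (c / v ^ Suc j)" if "v \<noteq> 0" for c v :: 'a
        using that by (cases j) (simp_all add: field_simps)
      then show ?thesis using nz(1)[OF u] .
    qed
    finally show ?thesis
      unfolding p_def falling_factorial_Suc mult.assoc by (rule DERIV_cmult)
  qed
  have q: "(q m has_field_derivative q (Suc m) u) (at u)" if u: "u \<in> S" for m u
  proof -
    have "((\<lambda>u. 1 / (2 + u) ^ Suc m) has_field_derivative
        - (of_nat (Suc m) * (2 + u) ^ m) / ((2 + u) ^ Suc m * (2 + u) ^ Suc m)) (at u)"
      using nz(2)[OF u] by (auto intro!: derivative_eq_intros simp del: power_Suc)
    also have "- (of_nat (Suc m) * (2 + u) ^ m) / ((2 + u) ^ Suc m * (2 + u) ^ Suc m) =
        - of_nat (Suc m) * (1 / (2 + u) ^ Suc (Suc m))"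
    proof -
      have "- (of_nat (Suc m) * v ^ m) / (v ^ Suc m * v ^ Suc m) =
          - of_nat (Suc m) * (1 / v ^ Suc (Suc m))" if "v \<noteq> 0" for v :: 'a
        using that by (simp add: field_simps)
      then show ?thesis using nz(2)[OF u] .
    qed
    finally have "(q m has_field_derivative
        (-1) ^ m * fact m * (- of_nat (Suc m) * (1 / (2 + u) ^ Suc (Suc m)))) (at u)"
      unfolding q_def by (rule DERIV_cmult)
    then show ?thesis
      by (simp add: q_def algebra_simps)
  qed
  have F: "F x = (\<lambda>u. p 0 u * q 0 u)"
    by (simp add: F_def p_def q_def falling_factorial_def fun_eq_iff)
  have "(deriv ^^ N) (F x) t = (\<Sum>j\<le>N. of_nat (N choose j) * (p j t * q (N - j) t))"
    unfolding F by (rule funpow_deriv_mult[of S p q, OF S p q t])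
  also have "\<dots> = (\<Sum>i = 0..N. coeff_a i N x * (1 + t) powi (- int i) *
      (2 + t) powi (int i - int N) * F x t)"
  proof (rule sum.cong)
    fix j assume "j \<in> {0..N}"
    then have j: "j \<le> N" by simp
    \<comment> \<open>Both integer powers become inverses of natural powers. The one factor
      \<open>1 / (2 + t)\<close> left over from \<open>q (N - j) t\<close> joins
      \<open>(1 + t) powr x\<close> to form \<open>F x t\<close>.\<close>
    then have "int j - int N = - int (N - j)" by simp
    then show "of_nat (N choose j) * (p j t * q (N - j) t) =
        coeff_a j N x * (1 + t) powi (- int j) * (2 + t) powi (int j - int N) * F x t"
      using j by (simp only: power_int_minus power_int_of_nat coeff_a_eq_choose p_def q_def F_def)
        (simp add: divide_inverse mult_ac)
  qed (simp add: atLeast0AtMost)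
  finally show ?thesis
    by (simp add: sum_distrib_right)
qed

theorem theorem2p1:
  fixes N :: nat and x t :: real and z w :: complex
  shows "(-1 < t \<longrightarrow>
      (deriv ^^ N) (\<lambda>u. F x u) t =
        (\<Sum>i = 0..N. coeff_a i N x * (1 + t) powi (- int i) * (2 + t) powi (int i - int N)) * F x t) \<and>
    (1 + w \<notin> \<real>\<^sub>\<le>\<^sub>0 \<longrightarrow>
      (deriv ^^ N) (\<lambda>u. F z u) w =
        (\<Sum>i = 0..N. coeff_a i N z * (1 + w) powi (- int i) * (2 + w) powi (int i - int N)) * F z w)"
proof (intro conjI impI)
  assume "-1 < t"
  then show "(deriv ^^ N) (\<lambda>u. F x u) t =
      (\<Sum>i = 0..N. coeff_a i N x * (1 + t) powi (- int i) * (2 + t) powi (int i - int N)) * F x t"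
  proof (intro funpow_deriv_F[of "{-1<..}"])
    fix u :: real assume "u \<in> {-1<..}"
    then show "((\<lambda>u. (1 + u) powr x) has_field_derivative x * (1 + u) powr x / (1 + u)) (at u)"
      by (auto intro!: derivative_eq_intros simp: powr_diff)
  qed auto
next
  assume w: "1 + w \<notin> \<real>\<^sub>\<le>\<^sub>0"
  \<comment> \<open>The plane slit along the real half-line up to -1, where the principal branch of
    \<open>(1 + u) powr z\<close> is holomorphic.\<close>
  let ?S = "(\<lambda>u. 1 + u) -` (- \<real>\<^sub>\<le>\<^sub>0) :: complex set"
  show "(deriv ^^ N) (\<lambda>u. F z u) w =
      (\<Sum>i = 0..N. coeff_a i N z * (1 + w) powi (- int i) * (2 + w) powi (int i - int N)) * F z w"
  proof (rule funpow_deriv_F[of ?S])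
    show "open ?S"
      by (intro continuous_open_vimage continuous_intros) auto
    fix u assume u: "u \<in> ?S"
    then show "1 + u \<noteq> 0" by auto
    \<comment> \<open>The pole at -2 lies on the slit, since there
      \<open>1 + u = -1\<close>.\<close>
    show "2 + u \<noteq> 0"
    proof
      assume "2 + u = 0"
      moreover have "1 + u = (2 + u) - 1" by simp
      ultimately have "1 + u = -1" by (simp only:) simp
      moreover have "1 + u \<notin> \<real>\<^sub>\<le>\<^sub>0" using u by simp
      ultimately show False by (simp only:) simp
    qed
    show "((\<lambda>u. (1 + u) powr z) has_field_derivative z * (1 + u) powr z / (1 + u)) (at u)"
      using u by (auto intro!: derivative_eq_intros simp: powr_diff)
  qed (use w in simp)
qed

end
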